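(* Let $n \geq 2$ be an integer and let $m \in \mathbb{Z}$ be arbitrary. Let $f_0(x) = x^2 + m$, and let $s \in \mathbb{Z}$ be a square with $s > (f_0^{n-1}(0))^2$, such that $s$ is odd if either $m$ is even or $n$ is odd, and $s$ is even otherwise. Put $\gamma = s - f_0^n(0)$ and $f(x) = (x-\gamma)^2 + \gamma + m$. Then for every $i \geq n$, the polynomial $f^i$ is irreducible over $\mathbb{Q}$, and $\overline{f^i} \in (\mathbb{Z}/p\mathbb{Z})[x]$ is reducible for all primes $p \in \mathbb{Z}$.
   Context: For a polynomial $g$, $g^n$ denotes the $n$-th iterate of $g$ (the $n$-fold composition of $g$ with itself), not the $n$-th power; in particular $f_0^n(0)$ is the value at $0$ of the $n$-th iterate of $f_0$. $\overline{g}$ denotes the coefficient-wise reduction of a polynomial $g \in \mathbb{Z}[x]$ modulo a prime $p$. *)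

theory Defs
  imports
    Berlekamp_Zassenhaus.Poly_Mod
    "HOL-Computational_Algebra.Nth_Powers"
begin

definition poly_iterate :: "'a::comm_semiring_1 poly \<Rightarrow> nat \<Rightarrow> 'a poly"
  where "poly_iterate g n = (pcompose g ^^ n) [:0, 1:]"

text \<open>
  As in the theory \<^theory>\<open>Berlekamp_Zassenhaus.Poly_Mod\<close>, elements of $(\mathbb{Z}/p\mathbb{Z})[x]$ are
  represented by integer polynomials, with equality, units and irreducibility taken modulo \<open>p\<close>.
  Zero and units are neither reducible nor irreducible.
\<close>

definition reducible_mod :: "int \<Rightarrow> int poly \<Rightarrow> bool"
  where "reducible_mod p g \<longleftrightarrow>
    poly_mod.Mp p g \<noteq> 0 \<and> \<not> poly_mod.dvdm p g 1 \<and> \<not> poly_mod.irreducible_m p g"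

end

theory Submission
  imports Defs "Berlekamp_Zassenhaus.Factor_Bound"
begin

text \<open>
  Write \<open>F\<^sub>i\<close> for the \<open>i\<close>-th iterate of \<open>f0 = x\<^sup>2 + m\<close>. Since \<open>f\<close> is the conjugate of \<open>f0\<close> by the
  translation \<open>x \<mapsto> x + \<gamma>\<close>, its iterates are translates of \<open>P\<^sub>i = F\<^sub>i + \<gamma>\<close>. As \<open>f0\<close> depends on
  \<open>x\<^sup>2\<close> only, \<open>P\<^sub>i\<^sub>+\<^sub>1 = G(x\<^sup>2)\<close> with \<open>G = P\<^sub>i(x + m)\<close>, and both halves of the theorem ask when a
  polynomial \<open>G(x\<^sup>2)\<close> factors.

  Reducibility modulo \<open>p\<close>. For \<open>i \<ge> n\<close> we have \<open>f\<^sup>i = G(a\<^sup>2)\<close> with \<open>G = P\<^sub>n\<^sub>-\<^sub>1(x + m)\<close> of even degree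
  \<open>d = 2\<^sup>n\<^sup>-\<^sup>1\<close>, with \<open>G(0) = P\<^sub>n(0) = s\<close> a square, and with \<open>a\<close> monic. Suppose that \<open>h = G(a\<^sup>2)\<close> were
  irreducible modulo \<open>p\<close>. In the field \<open>\<int>[x]/(p, h)\<close> the element \<open>a\<^sup>2\<close> is a root of \<open>G\<close>, and its
  \<open>d\<close> conjugates \<open>(a\<^sup>2)^(p^j)\<close> are all the roots of \<open>G\<close>. Hence their product is \<open>G(0) = r\<^sup>2\<close>, so that
  \<open>A = \<Prod> a^(p^j) = \<plusminus> r\<close> is fixed by Frobenius, which forces \<open>a^(p^d) = a\<close>. But \<open>a\<close> has degree \<open>2d\<close>
  over the prime field, so no positive power of Frobenius below the \<open>2d\<close>-th can fix it. All of this
  is carried out by congruences modulo a prime ideal of \<open>\<int>[x]\<close>, so that no field depending on \<open>p\<close> has to be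
  constructed; the result is \<open>not_irreducible_m_pcompose_square\<close>.

  Irreducibility over \<open>\<rat>\<close>. By Gauss's lemma it suffices to work in \<open>\<int>[x]\<close>, by induction on \<open>i\<close>.
  If \<open>G\<close> is irreducible but \<open>G(x\<^sup>2)\<close> is not, then the norm \<open>u(x) u(-x)\<close> of a factor \<open>u\<close> shows that
  \<open>\<plusminus> G = A\<^sup>2 - x B\<^sup>2\<close> (\<open>reducible_in_square_var_imp_norm\<close>). For \<open>G = x + c\<close> with \<open>c = m + \<gamma>\<close> this is
  impossible because \<open>c = s - F\<^sub>n\<^sub>-\<^sub>1(0)\<^sup>2 > 0\<close>. At all later stages
  \<open>G \<equiv> (x\<^sup>e + k)\<^sup>2 + c\<close> modulo 4, and then it is impossible because \<open>c\<close> is odd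
  (\<open>not_norm_if_square_plus_odd_mod_4\<close>). The parity condition on \<open>s\<close> says precisely that \<open>c\<close> is odd.
\<close>

(* These names also denote constants for polynomials over a ring record. *)
hide_const (open) up_ring.coeff up_ring.monom

section \<open>Congruences modulo a prime ideal\<close>

text \<open>
  The middle binomial coefficients are divisible by \<open>p\<close>. Stated as a divisibility, this applies to
  \<open>\<int>[x]\<close> itself, which has characteristic 0.
\<close>
lemma prime_dvd_freshmans_dream:
  fixes a b :: "'a::comm_ring_1"
  assumes "prime p"
  shows "of_nat p dvd (a + b) ^ p - (a ^ p + b ^ p)"
proof -
  have p: "p > 1" using assms prime_gt_1_nat by blast
  have range: "{..p} = insert 0 (insert p {1..<p})" using p by auto
  have "(a + b) ^ p = (\<Sum>k\<le>p. of_nat (p choose k) * a ^ k * b ^ (p - k))"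
    by (rule binomial_ring)
  also have "\<dots> = b ^ p + (a ^ p + (\<Sum>k=1..<p. of_nat (p choose k) * a ^ k * b ^ (p - k)))"
    unfolding range using p by simp
  finally have "(a + b) ^ p - (a ^ p + b ^ p)
    = (\<Sum>k=1..<p. of_nat (p choose k) * a ^ k * b ^ (p - k))" by simp
  moreover have "of_nat p dvd (of_nat (p choose k) * a ^ k * b ^ (p - k) :: 'a)"
    if "k \<in> {1..<p}" for k
  proof -
    have "p dvd (p choose k)" using that assms by (intro dvd_choose_prime) auto
    then have "(of_nat p :: 'a) dvd of_nat (p choose k)" by (auto simp: dvd_def)
    then show ?thesis by simp
  qed
  ultimately show ?thesis by (auto intro: dvd_sum)
qed

text \<open>
  The residue ring is never formed: computing with representatives up to a prime ideal allows the
  prime \<open>p\<close> and the polynomial \<open>h\<close> of the ideal \<open>(p, h)\<close> to be ordinary variables, where a type of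
  residue classes could not depend on them.
\<close>
locale ring_prime_ideal =
  fixes I :: "'a::comm_ring_1 set"
  assumes add_mem: "a \<in> I \<Longrightarrow> b \<in> I \<Longrightarrow> a + b \<in> I"
    and mult_mem: "b \<in> I \<Longrightarrow> a * b \<in> I"
    and one_notin: "1 \<notin> I"
    and prime_mem: "a * b \<in> I \<Longrightarrow> a \<in> I \<or> b \<in> I"
    and nonempty: "I \<noteq> {}"
begin


abbreviation eq_mod (infix \<open>\<approx>\<close> 50) where "a \<approx> b \<equiv> a - b \<in> I"

lemma zero_mem: "0 \<in> I"
  using mult_mem[of _ 0] nonempty by auto

lemma uminus_mem: "a \<in> I \<Longrightarrow> - a \<in> I"
  using mult_mem[of a "-1"] by simp

lemma diff_mem: "a \<in> I \<Longrightarrow> b \<in> I \<Longrightarrow> a - b \<in> I"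
  using add_mem[OF _ uminus_mem, of a b] by simp

lemma dvd_mem: "a \<in> I \<Longrightarrow> a dvd b \<Longrightarrow> b \<in> I"
  by (metis dvdE mult.commute mult_mem)

lemma cong_refl: "a \<approx> a" using zero_mem by simp

lemma cong_sym: "a \<approx> b \<Longrightarrow> b \<approx> a"
  using uminus_mem[of "a - b"] by simp

lemma cong_trans [trans]: "a \<approx> b \<Longrightarrow> b \<approx> c \<Longrightarrow> a \<approx> c"
  using add_mem[of "a - b" "b - c"] by simp

lemma cong_add: "a \<approx> b \<Longrightarrow> c \<approx> d \<Longrightarrow> a + c \<approx> b + d"
  using add_mem[of "a - b" "c - d"] by (simp add: algebra_simps)

lemma cong_mult: assumes "a \<approx> b" "c \<approx> d" shows "a * c \<approx> b * d"
proof -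
  have "a * c - b * d = c * (a - b) + b * (c - d)" by (simp add: algebra_simps)
  then show ?thesis using add_mem[OF mult_mem mult_mem] assms by metis
qed

lemma cong_power: "a \<approx> b \<Longrightarrow> a ^ n \<approx> b ^ n"
  by (induction n) (auto intro: cong_mult simp: zero_mem)

lemma cong_mem: "a \<approx> b \<Longrightarrow> a \<in> I \<longleftrightarrow> b \<in> I"
  using diff_mem[of a "a - b"] add_mem[of "a - b" b] by auto

lemma power_mem: "a ^ n \<in> I \<Longrightarrow> a \<in> I"
  by (induction n) (use one_notin prime_mem in auto)

text \<open>
  A polynomial over an integral domain with more roots than its degree is zero; here the domain is
  the residue ring. Split off one linear factor at a time: primality makes the other elements of
  \<open>S\<close> roots of the cofactor.
\<close>
lemma coeff_mem_of_many_roots: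
  fixes D :: "'a poly"
  assumes "finite S" "degree D < card S" "\<And>b. b \<in> S \<Longrightarrow> poly D b \<in> I"
    "\<And>b c. b \<in> S \<Longrightarrow> c \<in> S \<Longrightarrow> b \<approx> c \<Longrightarrow> b = c"
  shows "coeff D k \<in> I"
  using assms
proof (induction S arbitrary: D k rule: finite_induct)
  case empty
  then show ?case by simp
next
  case (insert b S)
  define E where "E = synthetic_div D b"
  have D: "D = [:-b, 1:] * E + [:poly D b:]"
    unfolding E_def by (rule synthetic_div_correct'[symmetric])
  have E: "coeff E k \<in> I" for k
  proof (cases "degree D = 0")
    case True
    then have "E = 0" unfolding E_def by (simp add: synthetic_div_eq_0_iff)
    then show ?thesis using zero_mem by simp
  next
    case False
    show ?thesis
    proof (rule insert.IH)
      show "degree E < card S"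
        using insert False by (simp add: E_def degree_synthetic_div)
      fix c assume c: "c \<in> S"
      have "(c - b) * poly E c = poly D c - poly D b"
        using arg_cong[OF D, of "\<lambda>q. poly q c"] by (simp add: left_diff_distrib)
      then have "(c - b) * poly E c \<in> I"
        using insert.prems(2) c diff_mem by simp
      then show "poly E c \<in> I" using prime_mem insert.prems(3)[of c b] c insert.hyps by blast
    qed (use insert.prems in auto)
  qed
  have "coeff D k = (- b) * coeff E k + (if k = 0 then 0 else coeff E (k - 1))
      + (if k = 0 then poly D b else 0)"
    using arg_cong[OF D, of "\<lambda>q. coeff q k"] by (auto simp: coeff_pCons split: nat.splits)
  then show ?case using E insert.prems(2)[of b] zero_mem
    by (auto intro!: add_mem mult_mem diff_mem)
qed

end

locale ring_prime_ideal_char = ring_prime_ideal I for I :: "'a::comm_ring_1 set" +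
  fixes p :: nat
  assumes prime_p: "prime p" and p_mem: "of_nat p \<in> I"
begin


lemma frobenius_add: "(a + b) ^ p \<approx> a ^ p + b ^ p"
  using dvd_mem[OF p_mem prime_dvd_freshmans_dream[OF prime_p]] .

lemma frobenius_of_nat: "of_nat n ^ p \<approx> of_nat n"
proof (induction n)
  case 0
  then show ?case using prime_gt_0_nat[OF prime_p] zero_mem by (simp add: zero_power)
next
  case (Suc n)
  have "of_nat (Suc n) ^ p \<approx> 1 ^ p + of_nat n ^ p"
    using frobenius_add[of 1 "of_nat n"] by simp
  also have "1 ^ p + of_nat n ^ p \<approx> 1 + of_nat n"
    using cong_add[OF cong_refl Suc, of 1] by simp
  finally show ?case by simp
qed

text \<open>
  Fermat's little theorem, transported to the residue ring.
\<close>
lemma frobenius_of_int: "of_int z ^ p \<approx> of_int z"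
proof -
  define n where "n = nat (z mod int p)"
  have "z = int n + int p * (z div int p)"
    using prime_gt_0_nat[OF prime_p] by (simp add: n_def)
  then have "of_int z = (of_int (int n + int p * (z div int p)) :: 'a)" by (rule arg_cong)
  then have "of_int z - of_nat n = (of_int (z div int p) :: 'a) * of_nat p" by simp
  then have z: "of_int z \<approx> of_nat n" using mult_mem[OF p_mem] by metis
  have "of_int z ^ p \<approx> of_nat n ^ p" by (rule cong_power[OF z])
  also have "of_nat n ^ p \<approx> of_nat n" by (rule frobenius_of_nat)
  also have "of_nat n \<approx> of_int z" by (rule cong_sym[OF z])
  finally show ?thesis .
qed

lemma frobenius_diff: "(a - b) ^ p \<approx> a ^ p - b ^ p"
proof -
  have "a ^ p \<approx> (a - b) ^ p + b ^ p" using frobenius_add[of "a - b" b] by simp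
  then show ?thesis by (auto dest: cong_sym simp: algebra_simps)
qed

lemma frobenius_diff_iter: "(a - b) ^ (p ^ k) \<approx> a ^ (p ^ k) - b ^ (p ^ k)"
proof (induction k)
  case 0
  then show ?case by (simp add: zero_mem)
next
  case (Suc k)
  have "((a - b) ^ (p ^ k)) ^ p \<approx> (a ^ (p ^ k) - b ^ (p ^ k)) ^ p"
    by (rule cong_power[OF Suc])
  also have "(a ^ (p ^ k) - b ^ (p ^ k)) ^ p \<approx> (a ^ (p ^ k)) ^ p - (b ^ (p ^ k)) ^ p"
    by (rule frobenius_diff)
  finally show ?case by (simp add: power_mult[symmetric] mult.commute)
qed

lemma frobenius_inj: "a ^ (p ^ k) \<approx> b ^ (p ^ k) \<Longrightarrow> a \<approx> b"
  using frobenius_diff_iter[of a b k] cong_mem power_mem by blast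

end

section \<open>Integer polynomials modulo a prime\<close>

lemma Mp_eq_iff_dvd: "poly_mod.Mp p f = poly_mod.Mp p g \<longleftrightarrow> [:p:] dvd f - g"
  by (simp add: poly_eq_iff poly_mod.Mp_coeff poly_mod.M_def const_poly_dvd_iff mod_eq_dvd_iff)

lemma dvdm_iff: "poly_mod.dvdm p f g \<longleftrightarrow> (\<exists>w. [:p:] dvd g - f * w)"
  by (simp add: poly_mod.dvdm_def Mp_eq_iff_dvd)

text \<open>
  Separating the part divisible by \<open>p\<close> leaves a polynomial whose degree does not drop modulo \<open>p\<close>.
  This turns statements about degrees modulo \<open>p\<close> into statements about integer polynomials.
\<close>
lemma lead_coeff_nondvd_decomp:
  fixes v :: "int poly"
  obtains v1 w where "v = v1 + [:p:] * w" "v1 = 0 \<or> \<not> p dvd lead_coeff v1"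
    "degree v1 \<le> degree v"
proof -
  define v1 where "v1 = poly_mod.Mp p v"
  have "poly_mod.Mp p v = poly_mod.Mp p v1" by (simp add: v1_def poly_mod.Mp_Mp)
  then have "[:p:] dvd v - v1" by (simp add: Mp_eq_iff_dvd)
  then obtain w where "v - v1 = [:p:] * w" by (elim dvdE)
  then have 1: "v = v1 + [:p:] * w" by (simp add: algebra_simps)
  have "lead_coeff v1 mod p = lead_coeff v1"
    by (simp add: v1_def poly_mod.Mp_coeff poly_mod.M_def)
  then have "p dvd lead_coeff v1 \<Longrightarrow> v1 = 0" by (auto simp: dvd_eq_mod_eq_0)
  moreover have "degree v1 \<le> degree v" unfolding v1_def by (rule poly_mod.degree_m_le)
  ultimately show ?thesis using that[OF 1] by blast
qed

text \<open>
  A multiple of \<open>h\<close> that is nonzero modulo \<open>p\<close> has at least the degree of \<open>h\<close>, because \<open>h\<close> is monic. So the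
  elements of the ideal \<open>(p, h)\<close> of smaller degree are multiples of \<open>p\<close>.
\<close>
lemma dvd_monic_mult_diffD:
  fixes h q v :: "int poly"
  assumes h: "monic h" and q: "degree q < degree h" and dvd: "[:p:] dvd q - h * v"
  shows "[:p:] dvd v" "[:p:] dvd q"
proof -
  obtain v1 w where v: "v = v1 + [:p:] * w" and v1: "v1 = 0 \<or> \<not> p dvd lead_coeff v1"
    by (rule lead_coeff_nondvd_decomp)
  have "q - h * v1 = (q - h * v) + [:p:] * (h * w)" by (simp add: v algebra_simps)
  then have *: "[:p:] dvd q - h * v1" using dvd by (metis dvd_add dvd_triv_left)
  have "v1 = 0"
  proof (rule ccontr)
    assume nz: "v1 \<noteq> 0"
    have "degree (h * v1) \<ge> degree h" using h nz by (subst degree_mult_eq) auto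
    then have "coeff q (degree (h * v1)) = 0" using q by (intro coeff_eq_0) simp
    moreover have "p dvd coeff (q - h * v1) (degree (h * v1))"
      using * by (simp only: const_poly_dvd_iff)
    moreover have "lead_coeff (h * v1) = lead_coeff v1" using h by (simp add: lead_coeff_mult)
    ultimately show False using v1 nz by simp
  qed
  then show "[:p:] dvd v" using v by (simp del: mult_pCons_left)
  then show "[:p:] dvd q" using dvd by (metis diff_add_cancel dvd_add dvd_mult)
qed

lemma dvd_pcompose_monicD:
  fixes r a :: "int poly"
  assumes a: "monic a" "degree a > 0" and dvd: "[:p:] dvd r \<circ>\<^sub>p a"
  shows "[:p:] dvd r"
proof -
  obtain r1 w where r: "r = r1 + [:p:] * w" and r1: "r1 = 0 \<or> \<not> p dvd lead_coeff r1"
    by (rule lead_coeff_nondvd_decomp)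
  have "r \<circ>\<^sub>p a = r1 \<circ>\<^sub>p a + [:p:] * (w \<circ>\<^sub>p a)"
    by (simp add: r pcompose_add pcompose_mult del: mult_pCons_left)
  then have "[:p:] dvd r1 \<circ>\<^sub>p a"
    using dvd by (metis dvd_add_left_iff dvd_triv_left)
  then have "p dvd lead_coeff (r1 \<circ>\<^sub>p a)" by (simp only: const_poly_dvd_iff)
  moreover have "lead_coeff (r1 \<circ>\<^sub>p a) = lead_coeff r1"
    using a lead_coeff_comp[of a r1] by simp
  ultimately have "p dvd lead_coeff r1" by simp
  then have "r1 = 0" using r1 by blast
  then show ?thesis using r by (simp del: mult_pCons_left)
qed

lemma not_dvdm_one:
  fixes h :: "int poly"
  assumes "monic h" "degree h > 0" "\<not> is_unit p"
  shows "\<not> poly_mod.dvdm p h 1"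
proof
  assume "poly_mod.dvdm p h 1"
  then obtain w where "[:p:] dvd 1 - h * w" by (auto simp: dvdm_iff)
  then have "[:p:] dvd 1" using assms by (intro dvd_monic_mult_diffD(2)[of h 1]) auto
  then show False using assms by (simp add: const_poly_dvd_1)
qed

text \<open>
  The ideal \<open>(p, h)\<close> of \<open>\<int>[x]\<close>.
\<close>
definition pideal :: "int \<Rightarrow> int poly \<Rightarrow> int poly set"
  where "pideal p h = {f. \<exists>v. [:p:] dvd f - h * v}"

lemma pidealI: "[:p:] dvd f - h * v \<Longrightarrow> f \<in> pideal p h"
  by (auto simp: pideal_def)

lemma pideal_add: assumes "f \<in> pideal p h" "g \<in> pideal p h" shows "f + g \<in> pideal p h"
proof -
  from assms obtain v w where "[:p:] dvd f - h * v" "[:p:] dvd g - h * w" by (auto simp: pideal_def)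
  then have "[:p:] dvd (f - h * v) + (g - h * w)" by (rule dvd_add)
  then show ?thesis by (intro pidealI[of _ _ _ "v + w"]) (simp add: algebra_simps)
qed

lemma pideal_mult: assumes "f \<in> pideal p h" shows "g * f \<in> pideal p h"
proof -
  from assms obtain v where "[:p:] dvd f - h * v" by (auto simp: pideal_def)
  then have "[:p:] dvd g * (f - h * v)" by (rule dvd_mult)
  then show ?thesis by (intro pidealI[of _ _ _ "g * v"]) (simp add: algebra_simps)
qed

lemma pideal_const: "[:p:] dvd f \<Longrightarrow> f \<in> pideal p h"
  by (rule pidealI[of _ _ _ 0]) simp

lemma monic_division:
  fixes g c :: "'a::idom poly"
  assumes "monic g"
  obtains q r where "c = g * q + r" "r = 0 \<or> degree r < degree g"
proof -
  obtain q r where qr: "pseudo_divmod c g = (q, r)" by fastforce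
  have g: "g \<noteq> 0" using assms by auto
  from pseudo_divmod[OF g qr] assms that show ?thesis by simp
qed

text \<open>
  The ideal \<open>(p, h)\<close> is maximal when \<open>h\<close> is irreducible modulo \<open>p\<close>. The ideal \<open>J = (a, p, h)\<close> is generated
  modulo \<open>p\<close> by any monic element \<open>g\<close> of least degree. Then \<open>g\<close> divides \<open>h\<close> modulo \<open>p\<close>, hence is either a unit,
  and \<open>J\<close> contains 1, or associated to \<open>h\<close>, and then \<open>a\<close> would lie in \<open>(p, h)\<close>.
\<close>
lemma bezout_mod:
  fixes h a :: "int poly"
  assumes p: "prime p" and h: "monic h" and irr: "poly_mod.irreducible_m p h"
    and a: "a \<notin> pideal p h"
  obtains u where "a * u - 1 \<in> pideal p h"
proof -
  define J where "J = {f. \<exists>u. f - a * u \<in> pideal p h}"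
  have J_add: "f + g \<in> J" if "f \<in> J" "g \<in> J" for f g
  proof -
    from that obtain u v where "f - a * u \<in> pideal p h" "g - a * v \<in> pideal p h"
      by (auto simp: J_def)
    from pideal_add[OF this] show ?thesis
      by (auto simp: J_def algebra_simps intro!: exI[of _ "u + v"])
  qed
  have J_mult: "g * f \<in> J" if "f \<in> J" for f g
  proof -
    from that obtain u where "f - a * u \<in> pideal p h" by (auto simp: J_def)
    from pideal_mult[OF this, of g] show ?thesis
      by (auto simp: J_def algebra_simps intro!: exI[of _ "g * u"])
  qed
  have J_sup: "f \<in> J" if "f \<in> pideal p h" for f
    using that by (auto simp: J_def intro!: exI[of _ 0])
  have J_p: "[:p:] * f \<in> J" for f using J_sup pideal_const dvd_triv_left by blast
  have J_diff: "f - g \<in> J" if "f \<in> J" "g \<in> J" for f g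
    using J_add[OF that(1) J_mult[OF that(2), of "-1"]] by simp
  have "h \<in> J" by (rule J_sup, rule pidealI[of _ _ _ 1]) simp
  then have ex: "\<exists>g. g \<in> J \<and> monic g" using h by blast
  define g where "g = arg_min degree (\<lambda>g. g \<in> J \<and> monic g)"
  from ex have g: "g \<in> J" "monic g" and min: "\<And>f. f \<in> J \<Longrightarrow> monic f \<Longrightarrow> degree g \<le> degree f"
    using arg_min_natI[of "\<lambda>g. g \<in> J \<and> monic g" _ degree]
      arg_min_nat_le[of "\<lambda>g. g \<in> J \<and> monic g" _ degree] by (auto simp: g_def)
  have small: "[:p:] dvd r" if "r \<in> J" "r = 0 \<or> degree r < degree g" for r
  proof (cases "r = 0")
    case False
    obtain r1 w where r: "r = r1 + [:p:] * w" and r1: "r1 = 0 \<or> \<not> p dvd lead_coeff r1"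
      and deg: "degree r1 \<le> degree r"
      by (rule lead_coeff_nondvd_decomp)
    have "r1 = 0"
    proof (rule ccontr)
      assume nz: "r1 \<noteq> 0"
      \<comment> \<open>Making \<open>r1\<close> monic modulo \<open>p\<close> yields a monic element of \<open>J\<close> of degree below that of \<open>g\<close>.\<close>
      let ?n = "degree r1" and ?c = "lead_coeff r1"
      have "\<not> p dvd ?c" using r1 nz by blast
      then have "gcd ?c p = 1" using prime_imp_coprime[OF p]
        by (simp add: gcd.commute flip: coprime_iff_gcd_eq_1)
      then obtain t y where ty: "t * ?c + y * p = 1" using bezout_int[of ?c p] by auto
      define f where "f = [:t:] * r1 + [:p:] * monom y ?n"
      have "r1 = r - [:p:] * w" using r by simp
      then have "r1 \<in> J" using J_diff[OF that(1) J_p] by simp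
      then have "f \<in> J" unfolding f_def by (intro J_add J_mult J_p)
      moreover have "degree f \<le> ?n"
        unfolding f_def by (auto intro!: degree_add_le order.trans[OF degree_smult_le] degree_monom_le)
      moreover have "coeff f ?n = 1" using ty by (simp add: f_def mult.commute)
      ultimately have "monic f" "degree f = ?n" "f \<in> J"
        using le_degree[of f ?n] by auto
      then have "degree g \<le> ?n" using min by metis
      moreover have "?n < degree g" using that(2) deg False by auto
      ultimately show False by simp
    qed
    then show ?thesis using r by (simp del: mult_pCons_left)
  qed simp
  have g_divides: "\<exists>q. [:p:] dvd c - g * q" if "c \<in> J" for c
  proof -
    obtain q r where qr: "c = g * q + r" "r = 0 \<or> degree r < degree g"
      using monic_division[OF g(2)] by metis
    then have "r = c - q * g" by (simp add: mult.commute)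
    then have "r \<in> J" using that g J_diff J_mult by metis
    then have "[:p:] dvd r" using small qr(2) by blast
    then show ?thesis using qr(1) by (intro exI[of _ q]) simp
  qed
  obtain q where q: "[:p:] dvd h - g * q" using g_divides[OF \<open>h \<in> J\<close>] by blast
  then have "poly_mod.Mp p h = poly_mod.Mp p (g * q)" by (simp add: Mp_eq_iff_dvd)
  then consider "poly_mod.dvdm p g 1" | "poly_mod.dvdm p q 1"
    using irr by (auto simp: poly_mod.irreducible_m_def)
  then show ?thesis
  proof cases
    case 1
    then obtain w where "[:p:] dvd 1 - g * w" by (auto simp: dvdm_iff)
    then have "1 - g * w \<in> J" using pideal_const J_sup by blast
    from J_add[OF this J_mult[OF g(1), of w]] have "1 \<in> J" by (simp add: mult.commute)
    then obtain u where "1 - a * u \<in> pideal p h" by (auto simp: J_def)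
    from pideal_mult[OF this, of "-1"] show ?thesis using that by simp
  next
    case 2
    then obtain w where w: "[:p:] dvd 1 - q * w" by (auto simp: dvdm_iff)
    have "g - h * w = g * (1 - q * w) - w * (h - g * q)" by (simp add: algebra_simps)
    then have "[:p:] dvd g - h * w" using w q by (metis dvd_diff dvd_mult)
    then have gI: "g \<in> pideal p h" by (rule pidealI)
    have "a \<in> J" using pideal_const[of p 0 h] by (auto simp: J_def intro!: exI[of _ 1])
    then obtain q' where "[:p:] dvd a - g * q'" using g_divides by blast
    then have "a - g * q' \<in> pideal p h" by (rule pideal_const)
    from pideal_add[OF this pideal_mult[OF gI, of q']] have "a \<in> pideal p h"
      by (simp add: mult.commute)
    with a show ?thesis by blast
  qed
qed

lemma ring_prime_ideal_pideal:
  fixes p :: nat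
  assumes p: "prime p" and h: "monic h" "degree h > 0"
    and irr: "poly_mod.irreducible_m (int p) h"
  shows "ring_prime_ideal_char (pideal (int p) h) p"
proof
  have pi: "prime (int p)" using p by simp
  show "1 \<notin> pideal (int p) h"
    using not_dvdm_one[OF h, OF contrapos_pn[OF pi not_prime_unit]] by (auto simp: pideal_def dvdm_iff)
  fix f g :: "int poly"
  show "f \<in> pideal (int p) h \<or> g \<in> pideal (int p) h" if fg: "f * g \<in> pideal (int p) h"
  proof (rule disjCI)
    assume "g \<notin> pideal (int p) h"
    then obtain u where u: "g * u - 1 \<in> pideal (int p) h"
      using bezout_mod[OF pi h(1) irr] by blast
    have "f = u * (f * g) + (- f) * (g * u - 1)" by (simp add: algebra_simps)
    then show "f \<in> pideal (int p) h"
      using pideal_add[OF pideal_mult[OF fg] pideal_mult[OF u]] by metis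
  qed
next
  show "of_nat p \<in> pideal (int p) h" by (rule pideal_const) (simp add: of_nat_poly)
  then show "pideal (int p) h \<noteq> {}" by blast
qed (use p pideal_add pideal_mult in auto)

section \<open>Reducibility modulo every prime\<close>

lemma geometric_sum_shift: "(\<Sum>j<d. (p::nat) ^ j) * p + 1 = (\<Sum>j<d. p ^ j) + p ^ d"
  by (induction d) (auto simp: algebra_simps)

text \<open>
  In a residue ring of \<open>\<int>[x]\<close>, composition \<open>f \<circ>\<^sub>p a\<close> is evaluation of the integer polynomial \<open>f\<close> at the
  element \<open>a\<close>.
\<close>
locale int_poly_prime_ideal = ring_prime_ideal_char I p for I :: "int poly set" and p :: nat
begin

lemma cong_pcompose: "a \<approx> b \<Longrightarrow> f \<circ>\<^sub>p a \<approx> f \<circ>\<^sub>p b"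
proof (induction f)
  case 0
  then show ?case using zero_mem by simp
next
  case (pCons c f)
  then show ?case
    unfolding pcompose_pCons by (intro cong_add cong_refl cong_mult) auto
qed

lemma frobenius_pcompose: "(f \<circ>\<^sub>p a) ^ p \<approx> f \<circ>\<^sub>p (a ^ p)"
proof (induction f)
  case 0
  then show ?case using zero_mem prime_gt_0_nat[OF prime_p] by (simp add: zero_power)
next
  case (pCons c f)
  have "(pCons c f \<circ>\<^sub>p a) ^ p \<approx> [:c:] ^ p + (a * (f \<circ>\<^sub>p a)) ^ p"
    unfolding pcompose_pCons by (rule frobenius_add)
  also have "[:c:] ^ p + (a * (f \<circ>\<^sub>p a)) ^ p \<approx> [:c:] + a ^ p * (f \<circ>\<^sub>p (a ^ p))"
  proof (rule cong_add)
    show "[:c:] ^ p \<approx> [:c:]" using frobenius_of_int[of c] by (simp add: of_int_poly)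
    show "(a * (f \<circ>\<^sub>p a)) ^ p \<approx> a ^ p * (f \<circ>\<^sub>p (a ^ p))"
      unfolding power_mult_distrib by (intro cong_mult cong_refl pCons.IH)
  qed
  also have "[:c:] + a ^ p * (f \<circ>\<^sub>p (a ^ p)) = pCons c f \<circ>\<^sub>p (a ^ p)" by (simp only: pcompose_pCons)
  finally show ?case .
qed

lemma frobenius_pcompose_iter: "(f \<circ>\<^sub>p a) ^ (p ^ k) \<approx> f \<circ>\<^sub>p (a ^ (p ^ k))"
proof (induction k)
  case 0
  then show ?case using zero_mem by simp
next
  case (Suc k)
  have "((f \<circ>\<^sub>p a) ^ (p ^ k)) ^ p \<approx> (f \<circ>\<^sub>p (a ^ (p ^ k))) ^ p" by (rule cong_power[OF Suc])
  also have "(f \<circ>\<^sub>p (a ^ (p ^ k))) ^ p \<approx> f \<circ>\<^sub>p ((a ^ (p ^ k)) ^ p)" by (rule frobenius_pcompose)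
  finally show ?case by (simp add: power_mult[symmetric] mult.commute)
qed

text \<open>
  The hypothesis \<open>low\<close> implies that \<open>a\<close> has degree at least \<open>n\<close> over the prime field. If the \<open>t\<close>-th power of
  Frobenius fixes \<open>a\<close>, it fixes every polynomial expression in \<open>a\<close>. The expressions of degree below \<open>n\<close>
  with coefficients in \<open>{0..<p}\<close> are then \<open>p^n\<close> incongruent roots of \<open>T^(p^t) - T\<close>, so \<open>p^n \<le> p^t\<close>.
\<close>
lemma degree_le_if_frobenius_fixes:
  assumes fixed: "a ^ (p ^ t) \<approx> a" and t: "t > 0" and a: "monic a" "degree a > 0"
    and low: "\<And>q. q \<in> I \<Longrightarrow> degree q < n * degree a \<Longrightarrow> [:int p:] dvd q"
  shows "n \<le> t"
proof (rule ccontr)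
  assume "\<not> n \<le> t"
  then have tn: "t < n" by simp
  define L where "L = {xs. set xs \<subseteq> {0..<int p} \<and> length xs = n}"
  let ?F = "\<lambda>xs. Poly xs \<circ>\<^sub>p a"
  have p1: "p > 1" using prime_gt_1_nat[OF prime_p] .
  have distinct: "xs = ys" if xs: "xs \<in> L" and ys: "ys \<in> L" and eq: "?F xs \<approx> ?F ys" for xs ys
  proof -
    define r where "r = Poly xs - Poly ys"
    have "coeff r i = 0" if "i > n - 1" for i
      using that xs ys tn by (simp add: r_def L_def nth_default_beyond)
    then have "degree r \<le> n - 1" by (intro degree_le) blast
    then have "degree (r \<circ>\<^sub>p a) < n * degree a" using tn a by (simp add: degree_pcompose)
    moreover have "r \<circ>\<^sub>p a \<in> I" using eq by (simp add: r_def pcompose_diff)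
    ultimately have "[:int p:] dvd r" using low a dvd_pcompose_monicD by blast
    show "xs = ys"
    proof (rule nth_equalityI)
      show "length xs = length ys" using xs ys by (simp add: L_def)
      fix i assume i: "i < length xs"
      then have i': "i < length ys" using xs ys by (simp add: L_def)
      have "int p dvd coeff r i" using \<open>[:int p:] dvd r\<close> by (simp only: const_poly_dvd_iff)
      then have "int p dvd xs ! i - ys ! i" using i i' by (simp add: r_def nth_default_nth)
      then have "xs ! i mod int p = ys ! i mod int p" by (simp add: mod_eq_dvd_iff)
      moreover have "xs ! i \<in> {0..<int p}" "ys ! i \<in> {0..<int p}"
        using nth_mem[OF i] nth_mem[OF i'] xs ys unfolding L_def by blast+
      ultimately show "xs ! i = ys ! i" by simp
    qed
  qed
  define D :: "int poly poly" where "D = monom 1 (p ^ t) - monom 1 1"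
  have "inj_on ?F L" using distinct zero_mem by (intro inj_onI) simp
  then have card: "card (?F ` L) = p ^ n"
    by (simp add: card_image L_def card_lists_length_eq)
  have fin: "finite (?F ` L)" unfolding L_def by (intro finite_imageI finite_lists_length_eq) simp
  have pt: "p ^ t > 1" using one_less_power[OF p1 t] .
  have "coeff D (p ^ t) \<in> I"
  proof (rule coeff_mem_of_many_roots[OF fin])
    have "degree D \<le> p ^ t"
      unfolding D_def using pt by (intro degree_diff_le) (auto intro: order.trans[OF degree_monom_le])
    also have "\<dots> < p ^ n" using p1 tn by simp
    finally show "degree D < card (?F ` L)" by (simp add: card)
  next
    fix b assume "b \<in> ?F ` L"
    then obtain q where b: "b = q \<circ>\<^sub>p a" by blast
    have "b ^ (p ^ t) \<approx> q \<circ>\<^sub>p (a ^ (p ^ t))" unfolding b by (rule frobenius_pcompose_iter)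
    also have "q \<circ>\<^sub>p (a ^ (p ^ t)) \<approx> b" unfolding b by (rule cong_pcompose[OF fixed])
    finally show "poly D b \<in> I" by (simp add: D_def poly_monom)
  qed (use distinct in blast)
  moreover have "coeff D (p ^ t) = 1" using pt by (simp add: D_def)
  ultimately show False using one_notin by simp
qed

text \<open>
  Vieta's formula for the constant coefficient: \<open>G\<close> and \<open>\<Prod> (T - b j)\<close> are both monic of degree \<open>d\<close>, so their
  difference has too many roots modulo \<open>I\<close> for its degree.
\<close>
lemma coeff_0_cong_prod_roots:
  fixes G :: "int poly poly"
  assumes G: "monic G" "degree G = d" "d > 0"
    and root: "\<And>j. j < d \<Longrightarrow> poly G (b j) \<in> I"
    and distinct: "\<And>i j. i < j \<Longrightarrow> j < d \<Longrightarrow> \<not> b i \<approx> b j"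
  shows "coeff G 0 \<approx> (\<Prod>j<d. - b j)"
proof -
  define P where "P = (\<Prod>j<d. [:- b j, 1:])"
  have degP: "degree P = d"
    unfolding P_def by (subst degree_prod_eq_sum_degree) auto
  have monP: "monic P" unfolding P_def by (rule monic_prod) simp
  have inj: "i = j" if "i < d" "j < d" "b i \<approx> b j" for i j
    using distinct[of i j] distinct[of j i] that cong_sym[of "b i" "b j"] by (cases i j rule: linorder_cases) auto
  have injb: "inj_on b {..<d}" using inj zero_mem by (intro inj_onI) simp
  have "coeff (G - P) 0 \<in> I"
  proof (rule coeff_mem_of_many_roots[of "b ` {..<d}"])
    have "degree (G - P) \<noteq> d"
    proof
      assume *: "degree (G - P) = d"
      then have "G - P \<noteq> 0" using G by auto
      then have "coeff (G - P) d \<noteq> 0" using * leading_coeff_neq_0 by metis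
      then show False using G degP monP by simp
    qed
    moreover have "degree (G - P) \<le> d" using G degP by (intro degree_diff_le) auto
    ultimately show "degree (G - P) < card (b ` {..<d})" by (simp add: card_image[OF injb])
  next
    fix c assume "c \<in> b ` {..<d}"
    then obtain j where j: "j < d" "c = b j" by auto
    then have "poly P c = 0" unfolding P_def poly_prod by (intro prod_zero) (auto intro!: bexI[of _ j])
    then show "poly (G - P) c \<in> I" using root j by simp
  qed (use inj in auto)
  moreover have "coeff P 0 = (\<Prod>j<d. - b j)"
    by (simp add: P_def poly_0_coeff_0[symmetric] poly_prod)
  ultimately show ?thesis by simp
qed

text \<open>
  The core of the reducibility statement. The ideal \<open>I\<close> stands for \<open>(p, G(a\<^sup>2))\<close>; the hypothesis
  \<open>low\<close> gives \<open>a\<close> degree at least \<open>2d\<close> over the prime field, where \<open>d\<close> is the degree of \<open>G\<close>, and this contradicts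
  \<open>a^(p^d) = a\<close>.
\<close>
lemma pcompose_square_notin:
  fixes G a :: "int poly" and r :: int
  assumes G: "monic G" "even (degree G)" "degree G > 0" "coeff G 0 = r\<^sup>2"
    and a: "monic a" "degree a > 0"
    and low: "\<And>q. q \<in> I \<Longrightarrow> degree q < 2 * degree G * degree a \<Longrightarrow> [:int p:] dvd q"
  shows "G \<circ>\<^sub>p a\<^sup>2 \<notin> I"
proof
  define h where "h = G \<circ>\<^sub>p a\<^sup>2"
  define d where "d = degree G"
  assume "G \<circ>\<^sub>p a\<^sup>2 \<in> I"
  then have hI: "h \<in> I" by (simp add: h_def)
  have d: "d > 0" "even d" using G by (auto simp: d_def)
  have bound: "2 * d \<le> t" if "a ^ (p ^ t) \<approx> a" "t > 0" for t
    using that a low[folded d_def] by (rule degree_le_if_frobenius_fixes)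
  have aI: "a \<notin> I"
  proof
    assume "a \<in> I"
    then have "[:int p:] dvd a" using low[of a] a G by (simp add: d_def)
    then have "int p dvd lead_coeff a" by (simp only: const_poly_dvd_iff)
    then show False using a prime_p by simp
  qed
  define b where "b j = (a\<^sup>2) ^ (p ^ j)" for j
  have root: "poly (map_poly (\<lambda>c. [:c:]) G) (b j) \<in> I" for j
  proof -
    have "h ^ (p ^ j) \<approx> G \<circ>\<^sub>p b j" unfolding h_def b_def by (rule frobenius_pcompose_iter)
    moreover have "h ^ (p ^ j) \<in> I"
      using hI prime_p by (intro dvd_mem[OF hI]) (simp add: prime_gt_0_nat)
    ultimately have "G \<circ>\<^sub>p b j \<in> I" using cong_mem by blast
    then show ?thesis by (simp add: pcompose_altdef)
  qed
  \<comment> \<open>A coincidence gives \<open>a^(p^k) = \<plusminus> a\<close> with \<open>0 < k < d\<close>, so the \<open>2k\<close>-th power of Frobenius would fix \<open>a\<close>.\<close>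
  have distinct: "\<not> b i \<approx> b j" if "i < j" "j < d" for i j
  proof
    assume "b i \<approx> b j"
    define k where "k = j - i"
    have k: "k > 0" "k < d" "j = k + i" using that by (auto simp: k_def)
    have "(a\<^sup>2) ^ (p ^ i) \<approx> ((a\<^sup>2) ^ (p ^ k)) ^ (p ^ i)"
      using \<open>b i \<approx> b j\<close> by (simp add: b_def k(3) power_add power_mult)
    then have "(a\<^sup>2) \<approx> (a\<^sup>2) ^ (p ^ k)" by (rule frobenius_inj)
    then have "(a ^ (p ^ k))\<^sup>2 - a\<^sup>2 \<in> I"
      using cong_sym by (simp add: power_mult[symmetric] mult.commute)
    moreover have "(a ^ (p ^ k))\<^sup>2 - a\<^sup>2 = (a ^ (p ^ k) - a) * (a ^ (p ^ k) + a)"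
      by (simp add: power2_eq_square algebra_simps)
    ultimately consider "a ^ (p ^ k) \<approx> a" | "a ^ (p ^ k) + a \<in> I"
      using prime_mem by metis
    then show False
    proof cases
      case 1
      then show False using bound[OF 1] k by simp
    next
      case 2
      then have "a ^ (p ^ k) \<approx> 0 - a" by simp
      then have "(a ^ (p ^ k)) ^ (p ^ k) \<approx> (0 - a) ^ (p ^ k)" by (rule cong_power)
      also have "(0 - a) ^ (p ^ k) \<approx> 0 ^ (p ^ k) - a ^ (p ^ k)" by (rule frobenius_diff_iter)
      also have "0 ^ (p ^ k) - a ^ (p ^ k) \<approx> a"
        using uminus_mem[OF 2] prime_p by (simp add: prime_gt_0_nat zero_power)
      finally have "a ^ (p ^ (2 * k)) \<approx> a"
        by (simp add: power_mult[symmetric] mult_2 power_add)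
      then show False using bound[of "2 * k"] k by simp
    qed
  qed
  \<comment> \<open>\<open>A\<close> is a square root of the norm of \<open>a\<^sup>2\<close>; as the norm is \<open>r\<^sup>2\<close>, it is an integer \<open>z = \<plusminus> r\<close>.\<close>
  define A where "A = (\<Prod>j<d. a ^ (p ^ j))"
  have A: "A = a ^ (\<Sum>j<d. p ^ j)" by (simp add: A_def power_sum)
  have AI: "A \<notin> I" using aI power_mem unfolding A by blast
  have "coeff (map_poly (\<lambda>c. [:c:]) G) 0 \<approx> (\<Prod>j<d. - b j)"
  proof (rule coeff_0_cong_prod_roots[OF _ _ d(1) root distinct])
    show deg: "degree (map_poly (\<lambda>c. [:c:]) G) = d" by (simp add: d_def degree_map_poly)
    show "monic (map_poly (\<lambda>c. [:c:]) G)"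
      using G unfolding deg by (simp add: coeff_map_poly d_def)
  qed
  moreover have "(\<Prod>j<d. - b j) = A\<^sup>2"
    using d(2) by (simp add: prod_uminus A_def b_def prod_power_distrib power_mult[symmetric] mult.commute)
  moreover have "coeff (map_poly (\<lambda>c. [:c:]) G) 0 = (of_int r)\<^sup>2"
    using G(4) by (simp add: coeff_map_poly of_int_poly power2_eq_square)
  ultimately have "(of_int r)\<^sup>2 - A\<^sup>2 \<in> I" by simp
  moreover have "(of_int r)\<^sup>2 - A\<^sup>2 = (of_int r - A) * (of_int r + A)"
    by (simp add: power2_eq_square algebra_simps)
  ultimately consider "of_int r \<approx> A" | "of_int r + A \<in> I" using prime_mem by metis
  then obtain z :: int where z: "of_int z \<approx> A"
  proof cases
    case 2
    show ?thesis using that[of "- r"] uminus_mem[OF 2] by simp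
  qed
  have "A ^ p \<approx> of_int z ^ p" by (rule cong_power[OF cong_sym[OF z]])
  also have "of_int z ^ p \<approx> of_int z" by (rule frobenius_of_int)
  also note z
  finally have "A ^ p * a - A * a \<in> I" by (intro cong_mult cong_refl)
  \<comment> \<open>Frobenius shifts the factors of \<open>A\<close>, replacing \<open>a\<close> by \<open>a^(p^d)\<close>.\<close>
  moreover have "A ^ p * a = A * a ^ (p ^ d)"
    using geometric_sum_shift[of p d]
    unfolding A power_mult[symmetric] power_add[symmetric] power_Suc2[symmetric] by simp
  ultimately have "A * (a ^ (p ^ d) - a) \<in> I" by (simp add: algebra_simps)
  then have "a ^ (p ^ d) \<approx> a" using AI prime_mem by blast
  then show False using bound[of d] d by simp
qed

end

text \<open>
  For \<open>a = x\<close> and \<open>G\<close> irreducible modulo an odd \<open>p\<close>: a root of \<open>G\<close> is a square in its field because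
  its norm \<open>G(0)\<close> is a square in the prime field.
\<close>
theorem not_irreducible_m_pcompose_square:
  fixes G a :: "int poly" and p :: nat and r :: int
  assumes p: "prime p" and G: "monic G" "even (degree G)" "degree G > 0" "coeff G 0 = r\<^sup>2"
    and a: "monic a" "degree a > 0"
  shows "\<not> poly_mod.irreducible_m (int p) (G \<circ>\<^sub>p a\<^sup>2)"
proof
  define h where "h = G \<circ>\<^sub>p a\<^sup>2"
  define d where "d = degree G"
  assume "poly_mod.irreducible_m (int p) (G \<circ>\<^sub>p a\<^sup>2)"
  then have irr: "poly_mod.irreducible_m (int p) h" by (simp add: h_def)
  have a0: "a \<noteq> 0" using a by auto
  then have deg_a2: "degree (a\<^sup>2) = 2 * degree a" by (simp add: degree_power_eq)
  have "monic (a\<^sup>2)" using a by (simp only: lead_coeff_power power_one)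
  then have "monic h"
    unfolding h_def using G a deg_a2 by (subst lead_coeff_comp) auto
  moreover have "degree h = (2 * d) * degree a"
    unfolding h_def d_def degree_pcompose deg_a2 by simp
  ultimately have h: "monic h" "degree h = (2 * d) * degree a" by blast+
  have d: "d > 0" "even d" using G by (auto simp: d_def)
  define I where "I = pideal (int p) h"
  have "ring_prime_ideal_char I p"
    unfolding I_def using p h d a irr by (intro ring_prime_ideal_pideal) auto
  then interpret int_poly_prime_ideal I p by (simp add: int_poly_prime_ideal_def)
  have low: "[:int p:] dvd q" if "q \<in> I" "degree q < 2 * d * degree a" for q
    using that dvd_monic_mult_diffD(2)[OF h(1)] h(2) by (auto simp: I_def pideal_def)
  have "h \<in> I" unfolding I_def by (rule pidealI[of _ _ _ 1]) simp
  moreover have "h \<notin> I"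
    unfolding h_def using G a low by (intro pcompose_square_notin) (auto simp: d_def)
  ultimately show False by simp
qed

section \<open>Integer polynomials in the square of the variable\<close>

abbreviation sq_var :: "int poly" where "sq_var \<equiv> [:0, 0, 1:]"

lemma even_odd_parts:
  fixes u :: "'a::comm_ring_1 poly"
  obtains A B where "u = A \<circ>\<^sub>p [:0, 0, 1:] + [:0, 1:] * (B \<circ>\<^sub>p [:0, 0, 1:])"
proof (induction u arbitrary: thesis)
  case 0
  show ?case by (rule 0[of 0 0]) simp
next
  case (pCons c u)
  obtain A B where u: "u = A \<circ>\<^sub>p [:0, 0, 1:] + [:0, 1:] * (B \<circ>\<^sub>p [:0, 0, 1:])"
    by (rule pCons.IH)
  show ?case
    by (rule pCons.prems[of "pCons c B" A])
      (subst u, simp add: pcompose_pCons algebra_simps)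
qed

text \<open>
  The even and odd parts of a polynomial can be read off its coefficients, so divisibility of the
  polynomial by a constant passes to both parts.
\<close>
lemma coeff_even_odd_parts:
  fixes A B :: "'a::comm_ring_1 poly"
  defines "u \<equiv> A \<circ>\<^sub>p [:0, 0, 1:] + [:0, 1:] * (B \<circ>\<^sub>p [:0, 0, 1:])"
  shows "coeff u (2 * k) = coeff A k" "coeff u (2 * k + 1) = coeff B k"
proof -
  have X: "[:0, 0, 1:] = (monom 1 2 :: 'a poly)" by (simp add: monom_altdef power2_eq_square)
  have 1: "coeff (C \<circ>\<^sub>p [:0, 0, 1:]) (2 * k) = coeff C k"
    "coeff (C \<circ>\<^sub>p [:0, 0, 1:]) (2 * k + 1) = 0" for C :: "'a poly" and k
    unfolding X using coeff_pcompose_monom[of 0 2 C k] coeff_pcompose_monom[of 1 2 C k] by simp_all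
  show "coeff u (2 * k + 1) = coeff B k" using 1 by (simp add: u_def)
  show "coeff u (2 * k) = coeff A k"
    using 1(1)[of A k] 1(2)[of B "k - 1"] by (cases k) (simp_all add: u_def)
qed

lemma pcompose_square_var_eq_iff:
  fixes F G :: "int poly"
  shows "F \<circ>\<^sub>p sq_var = G \<circ>\<^sub>p sq_var \<longleftrightarrow> F = G"
  using pcompose_eq_0_iff[of sq_var "F - G"] by (simp add: pcompose_diff)

text \<open>
  A form of Capelli's criterion. If \<open>G(x\<^sup>2) = u v\<close>, the norms \<open>u(x) u(-x) = U(x\<^sup>2)\<close> and
  \<open>v(x) v(-x) = V(x\<^sup>2)\<close> satisfy \<open>U V = G\<^sup>2\<close>. As \<open>G\<close> is prime and neither norm is a unit, \<open>U\<close> is associated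
  to \<open>G\<close>; and \<open>U = A\<^sup>2 - x B\<^sup>2\<close> for the even part \<open>A\<close> and the odd part \<open>B\<close> of \<open>u\<close>.
\<close>
lemma reducible_in_square_var_imp_norm:
  fixes G :: "int poly"
  assumes G: "irreducible G" "degree G > 0" and red: "\<not> irreducible (G \<circ>\<^sub>p sq_var)"
  obtains A B \<epsilon> where "\<epsilon> = 1 \<or> \<epsilon> = - 1" "A\<^sup>2 - [:0, 1:] * B\<^sup>2 = [:\<epsilon>:] * G"
proof -
  define N where "N u = u * (u \<circ>\<^sub>p [:0, - 1:])" for u :: "int poly"
  have ex_norm: "\<exists>A B. N u = (A\<^sup>2 - [:0, 1:] * B\<^sup>2) \<circ>\<^sub>p sq_var" for u
  proof -
    obtain A B where u: "u = A \<circ>\<^sub>p sq_var + [:0, 1:] * (B \<circ>\<^sub>p sq_var)" by (rule even_odd_parts)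
    have X: "[:0, 1:] \<circ>\<^sub>p sq_var = sq_var" by (simp add: pcompose_pCons)
    have even: "(C \<circ>\<^sub>p sq_var) \<circ>\<^sub>p [:0, - 1:] = C \<circ>\<^sub>p sq_var" for C :: "int poly"
      unfolding pcompose_assoc[symmetric] by (simp add: pcompose_pCons)
    have u_neg: "u \<circ>\<^sub>p [:0, - 1:] = A \<circ>\<^sub>p sq_var - [:0, 1:] * (B \<circ>\<^sub>p sq_var)"
      unfolding u pcompose_add pcompose_mult even by (simp add: pcompose_pCons)
    have "N u = (A \<circ>\<^sub>p sq_var + [:0, 1:] * (B \<circ>\<^sub>p sq_var))
        * (A \<circ>\<^sub>p sq_var - [:0, 1:] * (B \<circ>\<^sub>p sq_var))"
      by (simp only: N_def u_neg u[symmetric])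
    also have "\<dots> = (A \<circ>\<^sub>p sq_var)\<^sup>2 - [:0, 1:]\<^sup>2 * (B \<circ>\<^sub>p sq_var)\<^sup>2"
      by (simp only: power2_eq_square algebra_simps)
    also have "[:0, 1:]\<^sup>2 = sq_var" by (simp add: power2_eq_square)
    also have "(A \<circ>\<^sub>p sq_var)\<^sup>2 - sq_var * (B \<circ>\<^sub>p sq_var)\<^sup>2 = (A\<^sup>2 - [:0, 1:] * B\<^sup>2) \<circ>\<^sub>p sq_var"
      by (simp only: pcompose_diff pcompose_mult power2_eq_square X)
    finally show ?thesis by blast
  qed
  define h where "h = G \<circ>\<^sub>p sq_var"
  have G0: "G \<noteq> 0" using G by auto
  have deg_h: "degree h = 2 * degree G" by (simp add: h_def degree_pcompose)
  then have "h \<noteq> 0" "\<not> is_unit h" using G by (auto simp: poly_dvd_1)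
  then obtain u v where uv: "h = u * v" "\<not> is_unit u" "\<not> is_unit v"
    using red unfolding irreducible_def h_def by blast
  obtain A B where U: "N u = (A\<^sup>2 - [:0, 1:] * B\<^sup>2) \<circ>\<^sub>p sq_var" using ex_norm by blast
  obtain C D where V: "N v = (C\<^sup>2 - [:0, 1:] * D\<^sup>2) \<circ>\<^sub>p sq_var" using ex_norm by blast
  define U' where "U' = A\<^sup>2 - [:0, 1:] * B\<^sup>2"
  define V' where "V' = C\<^sup>2 - [:0, 1:] * D\<^sup>2"
  have "h \<circ>\<^sub>p [:0, - 1:] = h"
    unfolding h_def pcompose_assoc[symmetric] by (simp add: pcompose_pCons)
  then have "N h = h * h" by (simp add: N_def)
  moreover have "N h = N u * N v" by (simp add: N_def uv(1) pcompose_mult mult_ac)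
  ultimately have "(U' * V') \<circ>\<^sub>p sq_var = (G * G) \<circ>\<^sub>p sq_var"
    by (simp add: U V U'_def V'_def h_def pcompose_mult)
  then have UV: "U' * V' = G * G" by (simp only: pcompose_square_var_eq_iff)
  have unit: "is_unit w" if "N w = W \<circ>\<^sub>p sq_var" "is_unit W" for w W
  proof -
    from that(2) obtain W' where "1 = W * W'" by (elim dvdE)
    from arg_cong[OF this, of "\<lambda>q. q \<circ>\<^sub>p sq_var"] that(1)
    have "is_unit (N w)" by (metis dvd_triv_left pcompose_1 pcompose_mult)
    then show ?thesis unfolding N_def by (rule dvd_mult_left)
  qed
  have nU: "\<not> is_unit U'" using unit[OF U] uv U'_def by blast
  have nV: "\<not> is_unit V'" using unit[OF V] uv V'_def by blast
  have prime: "prime_elem G" using G(1) by (simp add: irreducible_imp_prime_elem)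
  have "\<exists>e. is_unit e \<and> U' = G * e"
  proof -
    have "G dvd U' * V'" using UV by simp
    then consider "G dvd U'" | "G dvd V'" using prime_elem_dvd_multD[OF prime] by blast
    then show ?thesis
    proof cases
      case 1
      then obtain e where e: "U' = G * e" by (elim dvdE)
      then have "G = e * V'" using UV G0 by simp
      then show ?thesis using e nV irreducibleD[OF G(1)] by blast
    next
      case 2
      then obtain e where e: "V' = G * e" by (elim dvdE)
      then have *: "G = U' * e" using UV G0 by simp
      then have "is_unit e" using nU irreducibleD[OF G(1)] by blast
      then obtain e' where e': "1 = e * e'" by (elim dvdE)
      then have "U' = G * e'" using * by (simp add: mult.assoc)
      moreover have "is_unit e'" using e' by (metis dvd_triv_right)
      ultimately show ?thesis by blast
    qed
  qed
  then obtain e where e: "is_unit e" "U' = G * e" by blast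
  from e(1) obtain c where "e = [:c:]" "is_unit c" by (auto simp: is_unit_poly_iff)
  then have "c = 1 \<or> c = - 1" "A\<^sup>2 - [:0, 1:] * B\<^sup>2 = [:c:] * G"
    using e(2) by (auto simp: U'_def mult.commute)
  then show ?thesis by (rule that)
qed

text \<open>
  Frobenius modulo 2: \<open>A(x)\<^sup>2 \<equiv> A(x\<^sup>2)\<close>.
\<close>
lemma square_cong_pcompose_square_var:
  fixes A :: "int poly"
  shows "[:2:] dvd A\<^sup>2 - A \<circ>\<^sub>p sq_var"
proof (induction A)
  case 0
  then show ?case by simp
next
  case (pCons c A)
  have c: "[:2:] dvd [:c\<^sup>2 - c:]" by (simp add: power2_eq_square)
  have split: "pCons c A = [:c:] + [:0, 1:] * A" by simp
  have const: "[:c\<^sup>2 - c:] = [:c:] * [:c:] - [:c:]" by (simp add: power2_eq_square)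
  have X: "sq_var = [:0, 1:] * [:0, 1:]" by simp
  have ring: "(d + x * a)\<^sup>2 - (d + x * x * b) = d * d - d + x * x * (a\<^sup>2 - b) + 2 * (d * x * a)"
    for a b d x :: "int poly" by (simp add: power2_eq_square algebra_simps)
  have "(pCons c A)\<^sup>2 - pCons c A \<circ>\<^sub>p sq_var =
    [:c\<^sup>2 - c:] + sq_var * (A\<^sup>2 - A \<circ>\<^sub>p sq_var) + 2 * ([:c:] * [:0, 1:] * A)"
    unfolding pcompose_pCons const unfolding split X by (rule ring)
  then have "(pCons c A)\<^sup>2 - pCons c A \<circ>\<^sub>p sq_var =
    [:c\<^sup>2 - c:] + sq_var * (A\<^sup>2 - A \<circ>\<^sub>p sq_var) + [:2:] * ([:c:] * [:0, 1:] * A)"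
    by (simp only: numeral_poly)
  then show ?case using c pCons.IH by (simp only: dvd_add dvd_mult dvd_triv_left)
qed

text \<open>
  Modulo 2 the right-hand side is \<open>x\<^sup>2\<^sup>e + k + c\<close>, a polynomial in \<open>x\<^sup>2\<close>, and so are \<open>A\<^sup>2\<close> and \<open>B\<^sup>2\<close>. Comparing
  even and odd parts, \<open>B \<equiv> 0\<close> and \<open>A \<equiv> T\<close> modulo 2, where \<open>T = x\<^sup>e + k + c\<close>. Hence \<open>A\<^sup>2 - x B\<^sup>2 \<equiv> T\<^sup>2\<close> modulo 4.
  But the coefficient of \<open>x\<^sup>e\<close> is \<open>2 (k + c)\<close> in \<open>T\<^sup>2\<close> and \<open>\<plusminus> 2 k\<close> on the right, which differ modulo 4 for
  odd \<open>c\<close>.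
\<close>
lemma not_norm_if_square_plus_odd_mod_4:
  fixes A B W :: "int poly" and k c \<epsilon> :: int and e :: nat
  assumes e: "e > 0" and c: "odd c" and eps: "\<epsilon> = 1 \<or> \<epsilon> = - 1"
  shows "A\<^sup>2 - [:0, 1:] * B\<^sup>2 \<noteq> [:\<epsilon>:] * ((monom 1 e + [:k:])\<^sup>2 + [:c:] + [:4:] * W)"
proof
  define T where "T = monom 1 e + [:k + c:]"
  let ?G = "(monom 1 e + [:k:])\<^sup>2 + [:c:] + [:4:] * W"
  assume eq: "A\<^sup>2 - [:0, 1:] * B\<^sup>2 = [:\<epsilon>:] * ?G"
  have TG: "[:2:] dvd T\<^sup>2 - [:\<epsilon>:] * ?G"
  proof -
    have const: "[:c\<^sup>2 - c:] = [:c:] * [:c:] - [:c:]" "[:k + c:] = [:k:] + [:c:]"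
      "[:4:] = (4 :: int poly)" "[:2:] = (2 :: int poly)"
      by (simp_all add: power2_eq_square numeral_poly)
    have ring: "(x + (y + z))\<^sup>2 - ((x + y)\<^sup>2 + z + 4 * w) = z * z - z + 2 * (z * (x + y) - 2 * w)"
      for x y z w :: "int poly" by (simp add: power2_eq_square algebra_simps)
    have "T\<^sup>2 - ?G = [:c\<^sup>2 - c:] + [:2:] * ([:c:] * (monom 1 e + [:k:]) - [:2:] * W)"
      unfolding T_def const by (rule ring)
    moreover have "[:2:] dvd [:c\<^sup>2 - c:]" by (simp add: power2_eq_square)
    ultimately have 1: "[:2:] dvd T\<^sup>2 - ?G" by (simp only: dvd_add dvd_triv_left)
    have "[:2:] dvd [:1 - \<epsilon>:]" using eps by auto
    then have "[:2:] dvd (T\<^sup>2 - ?G) + [:1 - \<epsilon>:] * ?G" using 1 by (simp only: dvd_add dvd_mult2)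
    moreover have "(T\<^sup>2 - ?G) + [:1 - \<epsilon>:] * ?G = T\<^sup>2 - [:\<epsilon>:] * ?G"
      by (simp add: left_diff_distrib flip: one_pCons diff_pCons[of 1 0 \<epsilon> 0, simplified])
    ultimately show ?thesis by (simp only:)
  qed
  define u where "u = (T - A) \<circ>\<^sub>p sq_var + [:0, 1:] * (B \<circ>\<^sub>p sq_var)"
  have "u = (T\<^sup>2 - [:\<epsilon>:] * ?G) - (T\<^sup>2 - T \<circ>\<^sub>p sq_var) + (A\<^sup>2 - A \<circ>\<^sub>p sq_var)
      - [:0, 1:] * (B\<^sup>2 - B \<circ>\<^sub>p sq_var)"
    unfolding eq[symmetric] by (simp add: u_def pcompose_diff algebra_simps)
  then have u: "[:2:] dvd u"
    using TG square_cong_pcompose_square_var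
    by (simp only: dvd_add dvd_diff dvd_mult)
  have "[:2:] dvd T - A" "[:2:] dvd B"
    using u coeff_even_odd_parts[of "T - A" B, folded u_def]
    by (metis const_poly_dvd_iff)+
  then obtain E F where "T - A = [:2:] * E" and F: "B = [:2:] * F" by (elim dvdE)
  then have A: "A = T - [:2:] * E" by (simp add: algebra_simps)
  have "T\<^sup>2 - [:\<epsilon>:] * ((monom 1 e + [:k:])\<^sup>2 + [:c:])
      = [:4:] * ([:\<epsilon>:] * W + T * E - E\<^sup>2 + [:0, 1:] * F\<^sup>2)"
  proof -
    have const: "[:4:] = (4 :: int poly)" "[:2:] = (2 :: int poly)" by (simp_all add: numeral_poly)
    have ring: "t\<^sup>2 - z * g = 4 * (z * w + t * e - e\<^sup>2 + x * f\<^sup>2)"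
      if "(t - 2 * e)\<^sup>2 - x * (2 * f)\<^sup>2 = z * (g + 4 * w)" for t z g w e x f :: "int poly"
    proof -
      have "t\<^sup>2 - z * g = (t - 2 * e)\<^sup>2 - x * (2 * f)\<^sup>2 - z * g + 4 * (t * e - e\<^sup>2 + x * f\<^sup>2)"
        by (simp add: power2_eq_square algebra_simps)
      then show ?thesis unfolding that by (simp add: algebra_simps)
    qed
    show ?thesis using eq unfolding A F const by (rule ring)
  qed
  then have "[:4:] dvd T\<^sup>2 - [:\<epsilon>:] * ((monom 1 e + [:k:])\<^sup>2 + [:c:])" by (simp only: dvd_triv_left)
  then have "4 dvd coeff (T\<^sup>2 - [:\<epsilon>:] * ((monom 1 e + [:k:])\<^sup>2 + [:c:])) e"
    by (simp only: const_poly_dvd_iff)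
  moreover have "(monom 1 e + [:z:])\<^sup>2 = monom 1 (2 * e) + monom (2 * z) e + [:z\<^sup>2:]" for z :: int
  proof -
    have ring: "(x + y)\<^sup>2 = x * x + 2 * y * x + y * y" for x y :: "int poly"
      by (simp add: power2_eq_square algebra_simps)
    have "(monom 1 e + [:z:])\<^sup>2 = monom 1 e * monom 1 e + 2 * [:z:] * monom 1 e + [:z:] * [:z:]"
      using ring[of "monom 1 e" "[:z:]"] .
    moreover have "monom 1 e * monom 1 e = (monom 1 (2 * e) :: int poly)"
      by (simp add: mult_monom mult_2)
    moreover have "2 * [:z:] = [:2 * z:]" by (simp add: numeral_poly)
    moreover have "[:2 * z:] * monom 1 e = monom (2 * z) e" by (simp add: smult_monom)
    moreover have "[:z:] * [:z:] = [:z\<^sup>2:]" by (simp add: power2_eq_square)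
    ultimately show ?thesis by (simp only:)
  qed
  ultimately have "4 dvd 2 * (k + c) - \<epsilon> * (2 * k)"
    using e by (simp add: T_def coeff_pCons split: nat.splits)
  then have "4 dvd 2 * c" using eps
  proof (elim disjE)
    assume "4 dvd 2 * (k + c) - \<epsilon> * (2 * k)" "\<epsilon> = - 1"
    then have "4 dvd 4 * k + 2 * c" by (simp add: algebra_simps)
    then show "4 dvd 2 * c" by presburger
  qed (simp add: algebra_simps)
  then show False using c by presburger
qed

section \<open>Iterates\<close>

lemma iterate_0: "poly_iterate g 0 = [:0, 1:]"
  by (simp add: poly_iterate_def)

lemma iterate_Suc: "poly_iterate g (Suc n) = g \<circ>\<^sub>p poly_iterate g n"
  by (simp add: poly_iterate_def)

lemma iterate_add:
  "poly_iterate g (m + n) = poly_iterate g m \<circ>\<^sub>p poly_iterate g n"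
  by (induction m) (simp_all add: iterate_0 iterate_Suc pcompose_assoc pcompose_pCons)

lemma iterate_Suc': "poly_iterate g (Suc n) = poly_iterate g n \<circ>\<^sub>p (g :: 'a::comm_ring_1 poly)"
  using iterate_add[of g n 1] unfolding One_nat_def iterate_Suc[of g 0] iterate_0 pcompose_idR by simp

lemma monic_pcompose:
  fixes f g :: "'a::idom poly"
  assumes "monic f" "monic g" "degree g > 0"
  shows "monic (f \<circ>\<^sub>p g)"
  using assms by (subst lead_coeff_comp) auto

lemma monic_iterate:
  fixes g :: "int poly"
  assumes "monic g" "degree g > 0"
  shows "monic (poly_iterate g n)" "degree (poly_iterate g n) = degree g ^ n"
proof -
  have "monic (poly_iterate g n) \<and> degree (poly_iterate g n) = degree g ^ n"
  proof (induction n)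
    case (Suc n)
    then have "monic (g \<circ>\<^sub>p poly_iterate g n)" using assms by (intro monic_pcompose) auto
    moreover have "degree (g \<circ>\<^sub>p poly_iterate g n) = degree g ^ Suc n"
      using Suc by (simp add: degree_pcompose)
    ultimately show ?case unfolding iterate_Suc by blast
  qed (simp add: iterate_0)
  then show "monic (poly_iterate g n)" "degree (poly_iterate g n) = degree g ^ n" by auto
qed

text \<open>
  Translation is an automorphism of \<open>\<int>[x]\<close>.
\<close>
lemma irreducible_translate:
  fixes g :: "int poly"
  assumes "irreducible g"
  shows "irreducible (g \<circ>\<^sub>p [:c, 1:])"
proof (rule irreducibleI)
  have inv: "(q \<circ>\<^sub>p [:- d, 1:]) \<circ>\<^sub>p [:d, 1:] = q" for q :: "int poly" and d
  proof -
    have "[:- d, 1:] \<circ>\<^sub>p [:d, 1:] = [:0, 1:]" by (simp add: pcompose_pCons)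
    then show ?thesis by (simp only: pcompose_assoc[symmetric] pcompose_idR)
  qed
  have unit: "is_unit q" if "is_unit (q \<circ>\<^sub>p [:d, 1:])" for q :: "int poly" and d
  proof -
    from that obtain w where "1 = (q \<circ>\<^sub>p [:d, 1:]) * w" by (elim dvdE)
    from arg_cong[OF this, of "\<lambda>v. v \<circ>\<^sub>p [:- d, 1:]"]
    have "1 = q * (w \<circ>\<^sub>p [:- d, 1:])" using inv[of q "- d"] by (simp add: pcompose_mult)
    then show ?thesis by (rule dvdI)
  qed
  show "g \<circ>\<^sub>p [:c, 1:] \<noteq> 0" using assms pcompose_eq_0[of g "[:c, 1:]"] by auto
  show "\<not> is_unit (g \<circ>\<^sub>p [:c, 1:])" using unit[of g c] irreducible_not_unit[OF assms] by blast
  fix u v assume "g \<circ>\<^sub>p [:c, 1:] = u * v"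
  from arg_cong[OF this, of "\<lambda>v. v \<circ>\<^sub>p [:- c, 1:]"]
  have "g = (u \<circ>\<^sub>p [:- c, 1:]) * (v \<circ>\<^sub>p [:- c, 1:])"
    using inv[of g "- c"] by (simp add: pcompose_mult)
  then show "is_unit u \<or> is_unit v" using irreducibleD[OF assms] unit by blast
qed

lemma irreducible_monic_int_imp_rat:
  fixes g :: "int poly"
  assumes "irreducible g" "monic g"
  shows "irreducible (map_poly of_int g :: rat poly)"
proof -
  have "content g dvd lead_coeff g" by (rule content_dvd_coeff)
  then have "content g = 1" using assms(2) by (metis is_unit_normalize normalize_content)
  then have "irreducible\<^sub>d g" using assms(1) by (simp add: irreducible_primitive_connect)
  then have "irreducible\<^sub>d (map_poly rat_of_int g)" by (rule irreducible\<^sub>d_int_rat)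
  then show ?thesis by simp
qed

section \<open>The iterates of a monic quadratic polynomial\<close>

context
  fixes m \<gamma> :: int and f0 :: "int poly"
  assumes f0: "f0 = sq_var + [:m:]"
begin

lemma f0_pcompose: "f0 \<circ>\<^sub>p q = q\<^sup>2 + [:m:]"
  by (simp add: f0 pcompose_pCons power2_eq_square)

lemma iterate_Suc_pcompose:
  "poly_iterate f0 (Suc i) \<circ>\<^sub>p q = (poly_iterate f0 i \<circ>\<^sub>p q)\<^sup>2 + [:m:]"
  unfolding iterate_Suc pcompose_assoc[symmetric] by (rule f0_pcompose)

lemma f0_monic: "monic f0" "degree f0 = 2" by (simp_all add: f0)

lemma f0_translate_square: "f0 = [:m, 1:] \<circ>\<^sub>p sq_var"
  by (simp add: f0 pcompose_pCons)

text \<open>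
  Knowing the translated iterate modulo 2 determines its square, and hence the next iterate, modulo 4.
  This is the input for the mod 4 obstruction.
\<close>
lemma iterate_translate_mod_2:
  "\<exists>W. poly_iterate f0 i \<circ>\<^sub>p [:m, 1:] = monom 1 (2 ^ i) + [:(int i + 1) * m:] + [:2:] * W"
proof (induction i)
  case 0
  show ?case by (intro exI[of _ 0]) (simp add: iterate_0 pcompose_pCons monom_altdef)
next
  case (Suc i)
  then obtain W where W: "poly_iterate f0 i \<circ>\<^sub>p [:m, 1:]
      = monom 1 (2 ^ i) + [:(int i + 1) * m:] + [:2:] * W" by blast
  define k where "k = (int i + 1) * m"
  have "even (k\<^sup>2 + m - (k + m))" by (simp add: power2_eq_square)
  then obtain l where l: "k\<^sup>2 + m - (k + m) = 2 * l" by (elim evenE)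
  have ring: "(x + y + 2 * w)\<^sup>2 + z = x * x + (y * y + z) + 2 * (x * y + 2 * w * (x + y) + 2 * w * w)"
    for x y z w :: "int poly" by (simp add: power2_eq_square algebra_simps)
  have two: "[:2:] = (2 :: int poly)" by (simp add: numeral_poly)
  have km: "[:k:] * [:k:] + [:m:] = [:k + m:] + 2 * [:l:]"
    using l by (simp add: power2_eq_square flip: two)
  have "poly_iterate f0 (Suc i) \<circ>\<^sub>p [:m, 1:] = (monom 1 (2 ^ i) + [:k:] + 2 * W)\<^sup>2 + [:m:]"
    unfolding iterate_Suc_pcompose W k_def two ..
  also have "\<dots> = monom 1 (2 ^ i) * monom 1 (2 ^ i) + ([:k + m:] + 2 * [:l:])
      + 2 * (monom 1 (2 ^ i) * [:k:] + 2 * W * (monom 1 (2 ^ i) + [:k:]) + 2 * W * W)"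
    unfolding ring km ..
  also have "\<dots> = monom 1 (2 ^ Suc i) + [:k + m:] + [:2:] *
      ([:l:] + (monom 1 (2 ^ i) * [:k:] + 2 * W * (monom 1 (2 ^ i) + [:k:]) + 2 * W * W))"
    unfolding two mult_monom by (simp only: algebra_simps mult_1_right power_Suc mult_2)
  also have "k + m = (int (Suc i) + 1) * m" by (simp add: k_def algebra_simps)
  finally show ?case by blast
qed

text \<open>
  The step from \<open>i\<close> to \<open>i + 1\<close> substitutes \<open>x\<^sup>2\<close> into the irreducible translate \<open>G\<close>. A factorization
  would make \<open>\<plusminus> G\<close> a norm, which is impossible by positivity for \<open>i = 0\<close> and modulo 4 for \<open>i \<ge> 1\<close>.
\<close>
lemma irreducible_iterate_plus_const:
  assumes odd: "odd (m + \<gamma>)" and pos: "m + \<gamma> > 0"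
  shows "irreducible (poly_iterate f0 i + [:\<gamma>:])"
proof (induction i)
  case 0
  show ?case using irreducible_linear_poly[of 1 \<gamma>] by (simp add: iterate_0)
next
  case (Suc i)
  define G where "G = (poly_iterate f0 i + [:\<gamma>:]) \<circ>\<^sub>p [:m, 1:]"
  have G: "irreducible G" unfolding G_def by (rule irreducible_translate[OF Suc])
  have deg: "degree G > 0"
  proof -
    have "degree (poly_iterate f0 i + [:\<gamma>:]) = 2 ^ i"
      using monic_iterate[OF f0_monic(1), of i] f0_monic by (subst degree_add_eq_left) auto
    then show ?thesis by (simp add: G_def degree_pcompose)
  qed
  have "poly_iterate f0 (Suc i) + [:\<gamma>:] = G \<circ>\<^sub>p sq_var"
    unfolding G_def iterate_Suc' pcompose_assoc[symmetric] pcompose_add f0_translate_square[symmetric]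
    by (simp add: pcompose_pCons)
  moreover have "irreducible (G \<circ>\<^sub>p sq_var)"
  proof (rule ccontr)
    assume "\<not> irreducible (G \<circ>\<^sub>p sq_var)"
    then obtain A B \<epsilon> where eps: "\<epsilon> = 1 \<or> \<epsilon> = - 1"
      and AB: "A\<^sup>2 - [:0, 1:] * B\<^sup>2 = [:\<epsilon>:] * G"
      by (rule reducible_in_square_var_imp_norm[OF G deg])
    show False
    proof (cases i)
      case 0
      define c where "c = m + \<gamma>"
      have Gc: "G = [:c, 1:]" using 0 by (simp add: G_def iterate_0 pcompose_pCons c_def)
      have "(poly A (- c))\<^sup>2 + c * (poly B (- c))\<^sup>2 = 0"
        using arg_cong[OF AB, of "\<lambda>q. poly q (- c)"] by (simp add: Gc)
      moreover have "c > 0" using pos by (simp add: c_def)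
      ultimately have "poly A (- c) = 0" "poly B (- c) = 0"
        by (auto simp: add_nonneg_eq_0_iff)
      \<comment> \<open>Hence \<open>G\<^sup>2\<close> divides \<open>A\<^sup>2 - x B\<^sup>2 = \<plusminus> G\<close>.\<close>
      then have "G dvd A" "G dvd B" by (simp_all add: poly_eq_0_iff_dvd Gc)
      then obtain A' B' where A: "A = G * A'" and B: "B = G * B'" by (elim dvdE)
      have ring: "(g * a)\<^sup>2 - x * (g * b)\<^sup>2 = g * (g * (a\<^sup>2 - x * b\<^sup>2))"
        for g a b x :: "int poly" by (simp add: power2_eq_square algebra_simps)
      have "G * (G * (A'\<^sup>2 - [:0, 1:] * B'\<^sup>2)) = G * [:\<epsilon>:]"
        using AB unfolding A B ring by (simp only: mult.commute)
      moreover have "G \<noteq> 0" using Gc by simp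
      ultimately have "G * (A'\<^sup>2 - [:0, 1:] * B'\<^sup>2) = [:\<epsilon>:]"
        by (metis mult_left_cancel)
      moreover have "is_unit [:\<epsilon>:]" using eps by auto
      ultimately have "is_unit G" by (metis dvd_mult_left)
      then show False using irreducible_not_unit[OF G] by blast
    next
      case (Suc j)
      obtain W where W: "poly_iterate f0 j \<circ>\<^sub>p [:m, 1:]
          = monom 1 (2 ^ j) + [:(int j + 1) * m:] + [:2:] * W"
        using iterate_translate_mod_2 by blast
      define k where "k = (int j + 1) * m"
      have two: "[:2:] = (2 :: int poly)" "[:4:] = (4 :: int poly)" by (simp_all add: numeral_poly)
      have ring: "(x + y + 2 * w)\<^sup>2 + z = (x + y)\<^sup>2 + z + 4 * (w * (x + y) + w * w)"
        for x y z w :: "int poly" by (simp add: power2_eq_square algebra_simps)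
      have "G = (monom 1 (2 ^ j) + [:k:] + 2 * W)\<^sup>2 + [:m + \<gamma>:]"
        unfolding G_def Suc pcompose_add iterate_Suc_pcompose W k_def two
        by (simp add: pcompose_pCons)
      then have "A\<^sup>2 - [:0, 1:] * B\<^sup>2 = [:\<epsilon>:] * ((monom 1 (2 ^ j) + [:k:])\<^sup>2 + [:m + \<gamma>:]
          + [:4:] * (W * (monom 1 (2 ^ j) + [:k:]) + W * W))"
        using AB unfolding ring two by simp
      then show False using not_norm_if_square_plus_odd_mod_4[OF _ odd eps, of "2 ^ j"] by simp
    qed
  qed
  ultimately show ?case by simp
qed

lemma even_iterate:
  assumes "i \<ge> 1"
  shows "even (poly (poly_iterate f0 i) 0) \<longleftrightarrow> even m \<or> even i"
  using assms
proof (induction i rule: dec_induct)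
  case base
  show ?case by (simp add: iterate_0 iterate_Suc f0)
next
  case (step i)
  then show ?case by (auto simp: iterate_Suc f0_pcompose)
qed

end

section \<open>Irreducible over the rationals, reducible modulo every prime\<close>

theorem theorem1p1:
  fixes n :: nat and m s \<gamma> :: int and f0 f :: "int poly"
  assumes "n \<ge> 2"
    and "f0 = [:0, 1:]^2 + [:m:]"
    and "is_square s"
    and "s > (poly (poly_iterate f0 (n - 1)) 0)^2"
    and "if even m \<or> odd n then odd s else even s"
    and "\<gamma> = s - poly (poly_iterate f0 n) 0"
    and "f = [:-\<gamma>, 1:]^2 + [:\<gamma> + m:]"
  shows "\<forall>i\<ge>n. irreducible (map_poly of_int (poly_iterate f i) :: rat poly) \<and>
    (\<forall>p::int. prime p \<longrightarrow> reducible_mod p (poly_mod.Mp p (poly_iterate f i)))"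
proof (intro allI impI)
  fix i assume i: "i \<ge> n"
  have f0: "f0 = sq_var + [:m:]" using assms(2) by (simp add: power2_eq_square)
  obtain r where r: "s = r\<^sup>2" using assms(3) by (auto elim: is_nth_powerE)
  define F where "F = poly_iterate f0"
  have conj: "poly_iterate f k = (F k + [:\<gamma>:]) \<circ>\<^sub>p [:- \<gamma>, 1:]" for k
  proof (induction k)
    case 0
    show ?case by (simp add: F_def iterate_0 pcompose_pCons)
  next
    case (Suc k)
    have f_pcompose: "f \<circ>\<^sub>p q = (q - [:\<gamma>:])\<^sup>2 + [:\<gamma> + m:]" for q
    proof -
      have "[:- \<gamma>, 1:] \<circ>\<^sub>p q = q - [:\<gamma>:]" by (simp add: pcompose_pCons)
      then show ?thesis
        by (simp only: assms(7) power2_eq_square pcompose_add pcompose_mult pcompose_const)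
    qed
    have "poly_iterate f (Suc k) = (F k \<circ>\<^sub>p [:- \<gamma>, 1:])\<^sup>2 + [:m:] + [:\<gamma>:]"
      unfolding iterate_Suc Suc f_pcompose by (simp add: pcompose_add pcompose_pCons)
    also have "(F k \<circ>\<^sub>p [:- \<gamma>, 1:])\<^sup>2 + [:m:] = F (Suc k) \<circ>\<^sub>p [:- \<gamma>, 1:]"
      unfolding F_def iterate_Suc_pcompose[OF f0] ..
    finally show ?case by (simp add: pcompose_add pcompose_pCons)
  qed
  have n: "n = Suc (n - 1)" "n - 1 \<ge> 1" using assms(1) by auto
  have Fn: "poly (F n) 0 = (poly (F (n - 1)) 0)\<^sup>2 + m"
    unfolding F_def by (subst n(1)) (simp add: iterate_Suc f0_pcompose[OF f0])
  have c: "m + \<gamma> = s - (poly (F (n - 1)) 0)\<^sup>2"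
    using assms(6) Fn by (simp add: F_def)
  have pos: "m + \<gamma> > 0" using c assms(4) by (simp add: F_def)
  have "even (poly (F (n - 1)) 0) \<longleftrightarrow> even m \<or> even (n - 1)"
    unfolding F_def by (rule even_iterate[OF f0 n(2)])
  moreover have "even (n - 1) \<longleftrightarrow> odd n" using assms(1) by simp
  ultimately have odd: "odd (m + \<gamma>)" using c assms(5) by (auto split: if_splits)
  have monF: "monic (F k + [:\<gamma>:])" "degree (F k + [:\<gamma>:]) = 2 ^ k" for k
  proof -
    have F: "monic (F k)" "degree (F k) = 2 ^ k"
      using monic_iterate[OF f0_monic(1)[OF f0], of k] f0_monic(2)[OF f0] by (simp_all add: F_def)
    then show deg: "degree (F k + [:\<gamma>:]) = 2 ^ k" by (subst degree_add_eq_left) auto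
    show "monic (F k + [:\<gamma>:])" unfolding deg using F by (simp add: coeff_pCons split: nat.splits)
  qed
  have mon: "monic (poly_iterate f i)"
    unfolding conj by (rule monic_pcompose[OF monF(1)]) auto
  have "degree (poly_iterate f i) = 2 ^ i"
    unfolding conj degree_pcompose monF(2) by simp
  then have deg: "degree (poly_iterate f i) > 0" by simp
  have "irreducible (poly_iterate f i)"
    unfolding conj F_def
    by (rule irreducible_translate, rule irreducible_iterate_plus_const[OF f0 odd pos])
  then have Q: "irreducible (map_poly of_int (poly_iterate f i) :: rat poly)"
    using mon by (rule irreducible_monic_int_imp_rat)
  have "reducible_mod p (poly_mod.Mp p (poly_iterate f i))" if p: "prime p" for p :: int
  proof -
    \<comment> \<open>\<open>f\<^sup>i = f\<^sup>n \<circ> f\<^sup>i\<^sup>-\<^sup>n\<close>, and \<open>f\<^sup>n\<close> is a polynomial in \<open>(x - \<gamma>)\<^sup>2\<close>.\<close>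
    define G where "G = (F (n - 1) + [:\<gamma>:]) \<circ>\<^sub>p [:m, 1:]"
    define a where "a = F (i - n) \<circ>\<^sub>p [:- \<gamma>, 1:]"
    have G: "monic G" unfolding G_def by (rule monic_pcompose[OF monF(1)]) auto
    have "degree G = 2 ^ (n - 1)" unfolding G_def degree_pcompose monF(2) by simp
    then have degG: "even (degree G)" "degree G > 0" using n by auto
    have F: "monic (F (i - n))" "degree (F (i - n)) > 0"
      unfolding F_def using monic_iterate[OF f0_monic(1)[OF f0], of "i - n"] f0_monic(2)[OF f0]
      by simp_all
    have a: "monic a" unfolding a_def by (rule monic_pcompose[OF F(1)]) auto
    have dega: "degree a > 0" unfolding a_def degree_pcompose using F(2) by simp
    have translate: "F n = F (n - 1) \<circ>\<^sub>p [:m, 1:] \<circ>\<^sub>p sq_var"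
      unfolding F_def by (subst n(1), subst iterate_Suc')
        (simp only: pcompose_assoc[symmetric] f0_translate_square[OF f0, symmetric])
    have "coeff G 0 = poly (F n) 0 + \<gamma>"
      unfolding translate by (simp add: G_def poly_0_coeff_0[symmetric] poly_pcompose)
    then have G0: "coeff G 0 = r\<^sup>2" using assms(6) r by (simp add: F_def)
    have "F i = F n \<circ>\<^sub>p F (i - n)" using iterate_add[of f0 n "i - n"] i by (simp add: F_def)
    then have "poly_iterate f i = G \<circ>\<^sub>p (sq_var \<circ>\<^sub>p a)"
      unfolding conj G_def a_def translate
      by (simp only: pcompose_add pcompose_assoc pcompose_const)
    also have "sq_var \<circ>\<^sub>p a = a\<^sup>2" by (simp add: pcompose_pCons power2_eq_square)
    finally have fi: "poly_iterate f i = G \<circ>\<^sub>p a\<^sup>2" .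
    have "prime (nat p)" "int (nat p) = p" using p by (auto simp: prime_ge_0_int)
    then have "\<not> poly_mod.irreducible_m p (poly_iterate f i)"
      unfolding fi using not_irreducible_m_pcompose_square[OF _ G degG G0 a dega, of "nat p"] by simp
    moreover have "\<not> is_unit p" using p not_prime_unit by blast
    moreover have "\<not> poly_mod.dvdm p (poly_iterate f i) 1"
      using not_dvdm_one[OF mon deg \<open>\<not> is_unit p\<close>] .
    moreover have "poly_mod.Mp p (poly_iterate f i) \<noteq> 0"
    proof
      assume "poly_mod.Mp p (poly_iterate f i) = 0"
      then have "poly_mod.Mp p (poly_iterate f i) = poly_mod.Mp p 0" by (simp add: poly_mod.Mp_0)
      then have "p dvd lead_coeff (poly_iterate f i)"
        unfolding Mp_eq_iff_dvd by (simp only: const_poly_dvd_iff diff_0_right)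
      then show False using mon \<open>\<not> is_unit p\<close> by simp
    qed
    ultimately show ?thesis
      by (simp add: reducible_mod_def poly_mod.Mp_Mp poly_mod.Mp_dvdm poly_mod.irreducible_m_Mp)
  qed
  with Q show "irreducible (map_poly of_int (poly_iterate f i) :: rat poly) \<and>
    (\<forall>p::int. prime p \<longrightarrow> reducible_mod p (poly_mod.Mp p (poly_iterate f i)))" by blast
qed

end
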